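(* For $n\geq 1$, \[\sum_{\alpha\in \mathrm{PF}_n}\mathrm{tie}(\alpha)=(n-1)(n+1)^{n-2}.\]
   Context: Parking functions: $n$ cars enter a one-way street with spots $1,\dots,n$ in order; car $i$ has preferred spot $\alpha_i\in[n]$ and parks in spot $\alpha_i$ if free, otherwise in the next free spot after $\alpha_i$, if any. $\mathrm{PF}_n$ is the set of lists $\alpha\in[n]^n$ for which all cars park. $\mathrm{tie}(\alpha)$ is the number of ties of $\alpha$, i.e. positions $i\in[n-1]$ with $\alpha_i=\alpha_{i+1}$. *)

theory Defs
  imports Complex_Main
begin

text \<open>
  Spots are numbered 1 to n. The set \<open>occ\<close> contains the occupied spots; a car preferring
  spot \<open>a\<close> takes the first free spot from \<open>a\<close> onwards, and \<open>None\<close> means that it cannot park.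
\<close>

definition parking_spot :: "nat \<Rightarrow> nat set \<Rightarrow> nat \<Rightarrow> nat option" where
  "parking_spot n occ a =
     (if \<exists>s\<in>{a..n}. s \<notin> occ then Some (LEAST s. s \<in> {a..n} \<and> s \<notin> occ) else None)"

primrec all_park :: "nat \<Rightarrow> nat set \<Rightarrow> nat list \<Rightarrow> bool" where
  "all_park n occ [] \<longleftrightarrow> True"
| "all_park n occ (a # as) \<longleftrightarrow>
     (case parking_spot n occ a of
        None \<Rightarrow> False
      | Some s \<Rightarrow> all_park n (insert s occ) as)"

definition PF :: "nat \<Rightarrow> nat list set" where
  "PF n = {\<alpha>. length \<alpha> = n \<and> set \<alpha> \<subseteq> {1..n} \<and> all_park n {} \<alpha>}"

text \<open>List positions are counted from 0 here.\<close>

definition tie :: "nat list \<Rightarrow> nat" where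
  "tie \<alpha> = card {i. Suc i < length \<alpha> \<and> \<alpha> ! i = \<alpha> ! Suc i}"

lemma finite_PF: "finite (PF n)"
  by (rule finite_subset[OF _ finite_lists_length_eq[of "{1..n}" n]]) (auto simp: PF_def)

end

theory Submission
  imports Defs
begin

text \<open>
  The proof is Pollak's circle argument. Add one more spot \<open>0\<close> and bend the street into a circle
  of \<open>n + 1\<close> spots, so that a car that passes spot \<open>n\<close> goes on to \<open>0\<close>, \<open>1\<close>, and so on. On the
  circle every car parks, and \<open>n\<close> cars leave exactly one spot free. A word over \<open>{0..n}\<close> of length
  \<open>n\<close> is a parking function exactly when the free spot is \<open>0\<close> (\<open>PF_iff_spot_0_stays_free\<close>), since a
  car occupies \<open>0\<close> only if it prefers \<open>0\<close> or has run off the end of the street.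

  Rotating all preferences by \<open>r\<close> rotates the free spot by \<open>r\<close> (\<open>occupied_rotate\<close>) and keeps the
  ties. So each of the \<open>n + 1\<close> values of the free spot contributes the same number of ties, and the
  ties of all words are \<open>n + 1\<close> times those of the parking functions (\<open>sum_tie_words_eq_PF\<close>).
  Finally each of the \<open>n - 1\<close> pairs of adjacent positions is a tie in \<open>(n + 1) ^ (n - 1)\<close> of the
  words, which gives \<open>(n - 1) * (n + 1) ^ (n - 1)\<close> ties in all words (\<open>sum_tie_words\<close>).
\<close>

section \<open>Parking on a circle\<close>

text \<open>
  The distance \<open>k\<close> driven past the preferred spot is minimised, rather than the spot itself, because
  distances do not change under rotation. On a full circle the value is some arbitrary spot.
\<close>
definition circle_spot :: "nat \<Rightarrow> nat set \<Rightarrow> nat \<Rightarrow> nat" where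
  "circle_spot N occ a = (a + (LEAST k. (a + k) mod N \<notin> occ)) mod N"

primrec occupied :: "nat \<Rightarrow> nat set \<Rightarrow> nat list \<Rightarrow> nat set" where
  "occupied N occ [] = occ"
| "occupied N occ (a # as) = occupied N (insert (circle_spot N occ a) occ) as"

definition rotate_by :: "nat \<Rightarrow> nat \<Rightarrow> nat \<Rightarrow> nat" where
  "rotate_by N r x = (x + r) mod N"

lemma inj_on_rotate_by: "inj_on (rotate_by N r) {..<N}"
proof (rule inj_onI)
  fix x y assume *: "x \<in> {..<N}" "y \<in> {..<N}" "rotate_by N r x = rotate_by N r y"
  then obtain p q where "x + r + N * p = y + r + N * q"
    by (auto simp: rotate_by_def nat_mod_eq_iff)
  then have "(x + N * p) mod N = (y + N * q) mod N"
    by simp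
  then show "x = y"
    using * by simp
qed

lemma circle_spot_less: "N > 0 \<Longrightarrow> circle_spot N occ a < N"
  by (simp add: circle_spot_def)

lemma circle_spot_free:
  assumes "s < N" "s \<notin> occ" "a < N"
  shows "circle_spot N occ a \<notin> occ"
proof -
  \<comment> \<open>Driving on to \<open>0\<close> and from there to \<open>s\<close> reaches a free spot.\<close>
  have "(a + (N - a + s)) mod N \<notin> occ"
    using assms by simp
  then show ?thesis
    unfolding circle_spot_def by (rule LeastI)
qed

lemma occupied_mono: "occ \<subseteq> occupied N occ as"
proof (induction as arbitrary: occ)
  case (Cons a as)
  show ?case
    using Cons.IH[of "insert (circle_spot N occ a) occ"] by auto
qed simp

lemma occupied_subset:
  "N > 0 \<Longrightarrow> occ \<subseteq> {..<N} \<Longrightarrow> occupied N occ as \<subseteq> {..<N}"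
  by (induction as arbitrary: occ) (simp_all add: circle_spot_less)

lemma set_subset_occupied:
  assumes "set as \<subseteq> {..<N}"
  shows "set as \<subseteq> occupied N occ as"
  using assms
proof (induction as arbitrary: occ)
  case (Cons a as)
  \<comment> \<open>A free preferred spot is taken at distance \<open>0\<close>; an occupied one stays occupied.\<close>
  have "a \<in> insert (circle_spot N occ a) occ"
  proof (cases "a \<in> occ")
    case False
    then have "(LEAST k. (a + k) mod N \<notin> occ) = 0"
      using Cons.prems by (intro Least_eq_0) simp
    then show ?thesis
      using Cons.prems by (simp add: circle_spot_def)
  qed simp
  then show ?case
    using Cons occupied_mono[of "insert (circle_spot N occ a) occ" N as] by auto
qed simp

lemma card_occupied:
  assumes "occ \<subseteq> {..<N}" "set as \<subseteq> {..<N}" "card occ + length as \<le> N"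
  shows "card (occupied N occ as) = card occ + length as"
  using assms
proof (induction as arbitrary: occ)
  case (Cons a as)
  have fin: "finite occ"
    using Cons.prems(1) finite_subset by blast
  have "card occ < card {..<N}"
    using Cons.prems(3) by simp
  then obtain s where "s < N" "s \<notin> occ"
    using card_mono[OF fin, of "{..<N}"] by (metis lessThan_iff not_le subsetI)
  then have "circle_spot N occ a \<notin> occ"
    using Cons.prems by (intro circle_spot_free) auto
  then have "card (insert (circle_spot N occ a) occ) = Suc (card occ)"
    using fin by simp
  then show ?case
    using Cons by (simp add: circle_spot_less)
qed simp

text \<open>
  Rotation is injective on the circle, so the rotated car meets a free spot after exactly the same
  distances as the original one.
\<close>
lemma circle_spot_rotate:
  assumes "occ \<subseteq> {..<N}" "N > 0"
  shows "circle_spot N (rotate_by N r ` occ) (rotate_by N r a) = rotate_by N r (circle_spot N occ a)"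
proof -
  have shift: "(rotate_by N r a + k) mod N = rotate_by N r ((a + k) mod N)" for k
    by (simp add: rotate_by_def mod_simps ac_simps)
  have "rotate_by N r ((a + k) mod N) \<in> rotate_by N r ` occ \<longleftrightarrow> (a + k) mod N \<in> occ" for k
    using assms by (intro inj_on_image_mem_iff[OF inj_on_rotate_by]) auto
  then show ?thesis
    by (simp add: circle_spot_def shift)
qed

lemma occupied_rotate:
  assumes "occ \<subseteq> {..<N}" "N > 0"
  shows "occupied N (rotate_by N r ` occ) (map (rotate_by N r) as) = rotate_by N r ` occupied N occ as"
  using assms(1)
proof (induction as arbitrary: occ)
  case (Cons a as)
  then show ?case
    using Cons.IH[of "insert (circle_spot N occ a) occ"] assms(2)
    by (simp add: circle_spot_rotate circle_spot_less)
qed simp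

section \<open>Parking functions are the words that leave spot 0 free\<close>

lemma circle_spot_eqI:
  assumes "(a + k) mod N \<notin> occ" "\<And>j. j < k \<Longrightarrow> (a + j) mod N \<in> occ"
  shows "circle_spot N occ a = (a + k) mod N"
proof -
  have "(LEAST k. (a + k) mod N \<notin> occ) = k"
  proof (rule Least_equality)
    show "k \<le> j" if "(a + j) mod N \<notin> occ" for j
      using assms(2)[of j] that by (cases "j < k") auto
  qed (rule assms(1))
  then show ?thesis
    by (simp add: circle_spot_def)
qed

text \<open>
  As long as spot \<open>0\<close> is free, a car on the circle does the same as on the street, where
  failing to park means reaching \<open>0\<close>.
\<close>
lemma parking_spot_eq_circle_spot:
  assumes "0 \<notin> occ" "a \<in> {1..n}"
  shows "parking_spot n occ a =
    (if circle_spot (Suc n) occ a = 0 then None else Some (circle_spot (Suc n) occ a))"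
proof (cases "\<exists>s\<in>{a..n}. s \<notin> occ")
  case True
  define s where "s = (LEAST s. s \<in> {a..n} \<and> s \<notin> occ)"
  have s: "s \<in> {a..n} \<and> s \<notin> occ"
    using True LeastI_ex[of "\<lambda>s. s \<in> {a..n} \<and> s \<notin> occ", folded s_def] by blast
  have before: "t \<in> occ" if "a \<le> t" "t < s" for t
    using that s not_less_Least[of t "\<lambda>s. s \<in> {a..n} \<and> s \<notin> occ", folded s_def] by auto
  have "circle_spot (Suc n) occ a = (a + (s - a)) mod Suc n"
  proof (rule circle_spot_eqI)
    show "(a + (s - a)) mod Suc n \<notin> occ"
      using s by simp
    show "(a + j) mod Suc n \<in> occ" if "j < s - a" for j
    proof -
      have "a + j < s" "a + j < Suc n"
        using s that by auto
      then show ?thesis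
        using before[of "a + j"] by simp
    qed
  qed
  then have "circle_spot (Suc n) occ a = s"
    using s by simp
  moreover have "parking_spot n occ a = Some s"
    unfolding parking_spot_def s_def using True by (rule if_P)
  ultimately show ?thesis
    using s assms(2) by simp
next
  case False
  have "circle_spot (Suc n) occ a = (a + (Suc n - a)) mod Suc n"
  proof (rule circle_spot_eqI)
    show "(a + (Suc n - a)) mod Suc n \<notin> occ"
      using assms by simp
    show "(a + j) mod Suc n \<in> occ" if "j < Suc n - a" for j
    proof -
      have "a + j \<in> {a..n}"
        using that by simp
      then show ?thesis
        using False by (metis atLeastAtMost_iff le_imp_less_Suc mod_less)
    qed
  qed
  then have "circle_spot (Suc n) occ a = 0"
    using assms(2) by simp
  then show ?thesis
    using False unfolding parking_spot_def by simp
qed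

lemma all_park_iff_spot_0_stays_free:
  assumes "0 \<notin> occ" "set as \<subseteq> {1..n}"
  shows "all_park n occ as \<longleftrightarrow> 0 \<notin> occupied (Suc n) occ as"
  using assms
proof (induction as arbitrary: occ)
  case (Cons a as)
  let ?s = "circle_spot (Suc n) occ a"
  have spot: "parking_spot n occ a = (if ?s = 0 then None else Some ?s)"
    using Cons.prems by (intro parking_spot_eq_circle_spot) auto
  show ?case
  proof (cases "?s = 0")
    case True
    then show ?thesis
      using spot occupied_mono[of "insert 0 occ" "Suc n" as] by auto
  next
    case False
    then show ?thesis
      using spot Cons by simp
  qed
qed simp

definition words :: "nat \<Rightarrow> nat \<Rightarrow> nat list set" where
  "words N m = {\<alpha>. set \<alpha> \<subseteq> {..<N} \<and> length \<alpha> = m}"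

text \<open>
  A word that contains the letter \<open>0\<close> is no parking function, and on the circle it occupies \<open>0\<close>.
\<close>
lemma PF_iff_spot_0_stays_free:
  "PF n = {\<alpha> \<in> words (Suc n) n. 0 \<notin> occupied (Suc n) {} \<alpha>}"
proof -
  have "set \<alpha> \<subseteq> {1..n} \<and> all_park n {} \<alpha> \<longleftrightarrow> set \<alpha> \<subseteq> {..<Suc n} \<and> 0 \<notin> occupied (Suc n) {} \<alpha>" for \<alpha>
  proof (cases "set \<alpha> \<subseteq> {1..n}")
    case True
    then show ?thesis
      using all_park_iff_spot_0_stays_free[of "{}" \<alpha> n] by auto
  next
    case False
    have "0 \<in> set \<alpha>" if "set \<alpha> \<subseteq> {..<Suc n}"
    proof -
      obtain x where "x \<in> set \<alpha>" "x \<notin> {1..n}"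
        using False by blast
      moreover from this have "x = 0"
        using that by force
      ultimately show ?thesis by simp
    qed
    then show ?thesis
      using False set_subset_occupied[of \<alpha> "Suc n" "{}"] by blast
  qed
  then show ?thesis
    by (auto simp: PF_def words_def)
qed

section \<open>Counting ties\<close>

lemma finite_words: "finite (words N m)"
  unfolding words_def by (rule finite_lists_length_eq) simp

lemma card_words: "card (words N m) = N ^ m"
  unfolding words_def by (simp add: card_lists_length_eq)

lemma words_Suc: "words N (Suc m) = (\<lambda>(a, \<alpha>). a # \<alpha>) ` ({..<N} \<times> words N m)"
proof (rule set_eqI)
  fix \<beta>
  show "\<beta> \<in> words N (Suc m) \<longleftrightarrow> \<beta> \<in> (\<lambda>(a, \<alpha>). a # \<alpha>) ` ({..<N} \<times> words N m)"
    by (cases \<beta>) (auto simp: words_def)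
qed

lemma tie_Cons_Cons: "tie (a # b # \<alpha>) = (if a = b then 1 else 0) + tie (b # \<alpha>)"
proof -
  let ?T = "\<lambda>\<beta>. {i. Suc i < length \<beta> \<and> \<beta> ! i = \<beta> ! Suc i}"
  have "?T (a # b # \<alpha>) = (if a = b then {0} else {}) \<union> Suc ` ?T (b # \<alpha>)"
  proof (rule set_eqI)
    fix i
    show "i \<in> ?T (a # b # \<alpha>) \<longleftrightarrow> i \<in> (if a = b then {0} else {}) \<union> Suc ` ?T (b # \<alpha>)"
      by (cases i) auto
  qed
  moreover have "finite (?T (b # \<alpha>))"
    by (rule finite_subset[of _ "{..<length (b # \<alpha>)}"]) auto
  ultimately show ?thesis
    by (simp add: tie_def card_image)
qed

text \<open>
  A new first letter keeps all ties of the word behind it, and exactly one of its \<open>N\<close> choices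
  creates one more.
\<close>
lemma sum_tie_words: "(\<Sum>\<alpha>\<in>words N (Suc m). tie \<alpha>) = m * N ^ m"
proof (induction m)
  case 0
  then show ?case
    by (auto simp: words_def tie_def intro!: sum.neutral)
next
  case (Suc m)
  have step: "(\<Sum>a<N. tie (a # \<alpha>)) = N * tie \<alpha> + 1" if "\<alpha> \<in> words N (Suc m)" for \<alpha>
  proof -
    obtain b \<beta> where "\<alpha> = b # \<beta>" "b < N"
      using \<open>\<alpha> \<in> words N (Suc m)\<close> by (auto simp: words_Suc)
    then show ?thesis
      by (simp add: tie_Cons_Cons sum.distrib)
  qed
  have "(\<Sum>\<alpha>\<in>words N (Suc (Suc m)). tie \<alpha>)
      = (\<Sum>(a, \<alpha>)\<in>{..<N} \<times> words N (Suc m). tie (a # \<alpha>))"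
    unfolding words_Suc[of N "Suc m"]
    by (subst sum.reindex) (auto simp: inj_on_def case_prod_unfold)
  also have "\<dots> = (\<Sum>\<alpha>\<in>words N (Suc m). \<Sum>a<N. tie (a # \<alpha>))"
    by (subst sum.swap) (simp add: sum.cartesian_product)
  also have "\<dots> = (\<Sum>\<alpha>\<in>words N (Suc m). N * tie \<alpha> + 1)"
    by (intro sum.cong step refl)
  also have "\<dots> = N * (m * N ^ m) + N ^ Suc m"
    by (simp only: sum.distrib sum_distrib_left[symmetric] Suc.IH sum_constant card_words) simp
  finally show ?case
    by (simp add: algebra_simps)
qed

lemma tie_map:
  assumes "inj_on f A" "set \<alpha> \<subseteq> A"
  shows "tie (map f \<alpha>) = tie \<alpha>"
proof -
  have "f (\<alpha> ! i) = f (\<alpha> ! Suc i) \<longleftrightarrow> \<alpha> ! i = \<alpha> ! Suc i" if "Suc i < length \<alpha>" for i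
    using that assms by (intro inj_on_eq_iff[OF assms(1)]) (auto intro!: subsetD[OF assms(2)])
  then show ?thesis
    unfolding tie_def by (intro arg_cong[where f = card]) auto
qed

lemma bij_betw_rotate_words:
  assumes "N > 0"
  shows "bij_betw (map (rotate_by N r)) (words N m) (words N m)"
proof -
  have "inj_on (map (rotate_by N r)) (words N m)"
    by (rule inj_on_mapI[THEN inj_on_subset, of _ "words N m"])
       (auto simp: words_def intro: inj_on_subset[OF inj_on_rotate_by])
  moreover have "map (rotate_by N r) ` words N m \<subseteq> words N m"
    using assms by (auto simp: words_def rotate_by_def)
  ultimately show ?thesis
    by (simp add: bij_betw_def endo_inj_surj finite_words)
qed

lemma sum_tie_rotate:
  assumes "r < Suc n"
  shows "(\<Sum>\<alpha>\<in>{\<alpha> \<in> words (Suc n) n. r \<notin> occupied (Suc n) {} \<alpha>}. tie \<alpha>) = (\<Sum>\<alpha>\<in>PF n. tie \<alpha>)"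
proof -
  let ?rot = "rotate_by (Suc n) r"
  let ?free = "\<lambda>s \<alpha>. s \<notin> occupied (Suc n) {} \<alpha>"
  have free: "?free r (map ?rot \<alpha>) \<longleftrightarrow> ?free 0 \<alpha>" for \<alpha>
  proof -
    have "occupied (Suc n) {} (map ?rot \<alpha>) = ?rot ` occupied (Suc n) {} \<alpha>"
      using occupied_rotate[of "{}" "Suc n" r \<alpha>] by simp
    moreover have "r = ?rot 0"
      using assms by (simp add: rotate_by_def)
    moreover have "?rot 0 \<in> ?rot ` occupied (Suc n) {} \<alpha> \<longleftrightarrow> 0 \<in> occupied (Suc n) {} \<alpha>"
      by (intro inj_on_image_mem_iff[OF inj_on_rotate_by] occupied_subset) auto
    ultimately show ?thesis
      by metis
  qed
  have "(\<Sum>\<alpha>\<in>{\<alpha> \<in> words (Suc n) n. ?free r \<alpha>}. tie \<alpha>)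
      = (\<Sum>\<alpha>\<in>words (Suc n) n. if ?free r \<alpha> then tie \<alpha> else 0)"
    by (rule sum.inter_filter) (rule finite_words)
  also have "\<dots> = (\<Sum>\<alpha>\<in>words (Suc n) n. if ?free r (map ?rot \<alpha>) then tie (map ?rot \<alpha>) else 0)"
    by (rule sum.reindex_bij_betw[symmetric]) (simp add: bij_betw_rotate_words)
  also have "\<dots> = (\<Sum>\<alpha>\<in>words (Suc n) n. if ?free 0 \<alpha> then tie \<alpha> else 0)"
    by (intro sum.cong refl) (auto simp: free words_def tie_map[OF inj_on_rotate_by])
  also have "\<dots> = (\<Sum>\<alpha>\<in>PF n. tie \<alpha>)"
    unfolding PF_iff_spot_0_stays_free by (rule sum.inter_filter[symmetric]) (rule finite_words)
  finally show ?thesis .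
qed

lemma card_free_spots:
  assumes "\<alpha> \<in> words (Suc n) n"
  shows "card {r \<in> {..<Suc n}. r \<notin> occupied (Suc n) {} \<alpha>} = 1"
proof -
  have sub: "occupied (Suc n) {} \<alpha> \<subseteq> {..<Suc n}"
    by (rule occupied_subset) auto
  have "card (occupied (Suc n) {} \<alpha>) = n"
    using assms card_occupied[of "{}" "Suc n" \<alpha>] by (simp add: words_def)
  then have "card ({..<Suc n} - occupied (Suc n) {} \<alpha>) = 1"
    using sub by (subst card_Diff_subset) (auto intro: finite_subset)
  then show ?thesis
    by (simp add: set_diff_eq)
qed

text \<open>Sorting the words by their only free spot splits the sum into \<open>n + 1\<close> equal parts.\<close>
lemma sum_tie_words_eq_PF:
  "(\<Sum>\<alpha>\<in>words (Suc n) n. tie \<alpha>) = Suc n * (\<Sum>\<alpha>\<in>PF n. tie \<alpha>)"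
proof -
  let ?free = "\<lambda>r \<alpha>. r \<notin> occupied (Suc n) {} \<alpha>"
  have "(\<Sum>\<alpha>\<in>words (Suc n) n. tie \<alpha>)
      = (\<Sum>\<alpha>\<in>words (Suc n) n. \<Sum>r\<in>{r \<in> {..<Suc n}. ?free r \<alpha>}. tie \<alpha>)"
    by (intro sum.cong refl) (simp only: sum_constant card_free_spots mult_1 of_nat_1 of_nat_id)
  also have "\<dots> = (\<Sum>r<Suc n. \<Sum>\<alpha>\<in>{\<alpha> \<in> words (Suc n) n. ?free r \<alpha>}. tie \<alpha>)"
    by (rule sum.swap_restrict) (simp_all add: finite_words)
  also have "\<dots> = (\<Sum>r<Suc n. \<Sum>\<alpha>\<in>PF n. tie \<alpha>)"
    by (intro sum.cong refl sum_tie_rotate) simp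
  finally show ?thesis
    by simp
qed

theorem corollary5p14:
  fixes n :: nat
  assumes "n \<ge> 1"
  shows "real (\<Sum>\<alpha>\<in>PF n. tie \<alpha>) = (real n - 1) * (real n + 1) powi (int n - 2)"
proof -
  have "Suc n * (\<Sum>\<alpha>\<in>PF n. tie \<alpha>) = (n - 1) * Suc n ^ (n - 1)"
    using sum_tie_words[of "Suc n" "n - 1"] sum_tie_words_eq_PF[of n] assms by simp
  then have "real (Suc n) * real (\<Sum>\<alpha>\<in>PF n. tie \<alpha>) = real (n - 1) * real (Suc n) ^ (n - 1)"
    by (simp only: of_nat_mult[symmetric] of_nat_power[symmetric])
  moreover have "real (Suc n) = real n + 1" "real (n - 1) = real n - 1"
    using assms by (simp_all add: of_nat_diff)
  ultimately have "(real n + 1) * real (\<Sum>\<alpha>\<in>PF n. tie \<alpha>) = (real n - 1) * (real n + 1) ^ (n - 1)"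
    by (simp only:)
  \<comment> \<open>The integer exponent is \<open>-1\<close> for \<open>n = 1\<close>, so the common factor is split off as \<open>powi\<close>.\<close>
  also have "(real n + 1) ^ (n - 1) = (real n + 1) powi ((int n - 2) + 1)"
    using assms by (simp flip: power_int_of_nat add: of_nat_diff)
  also have "\<dots> = (real n + 1) powi (int n - 2) * (real n + 1)"
    by (rule power_int_add_1) simp
  finally have "(real n + 1) * real (\<Sum>\<alpha>\<in>PF n. tie \<alpha>)
      = (real n + 1) * ((real n - 1) * (real n + 1) powi (int n - 2))"
    by (simp only: ac_simps)
  then show ?thesis
    by (subst (asm) mult_left_cancel) simp_all
qed

end
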